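(* Let $f,\bar f:[0,1]\to[\frac12,1]$ be the functions defined, for $\alpha_n\in\{0,1\}$, by $$f\left(\Delta^2_{\alpha_1\alpha_2\ldots\alpha_{2n-1}\alpha_{2n}\ldots}\right)=\Delta^{A_2}_{\left(\frac12\right)^{1-\alpha_1}\left(\frac12\right)^{\alpha_2}\ldots\left(\frac12\right)^{1-\alpha_{2n-1}}\left(\frac12\right)^{\alpha_{2n}}\ldots},$$ $$\bar f\left(\Delta^2_{\alpha_1\alpha_2\ldots\alpha_{2n-1}\alpha_{2n}\ldots}\right)=\Delta^{A_2}_{\left(\frac12\right)^{\alpha_1}\left(\frac12\right)^{1-\alpha_2}\ldots\left(\frac12\right)^{\alpha_{2n-1}}\left(\frac12\right)^{1-\alpha_{2n}}\ldots},$$ and let $I:[\frac12,1]\to[\frac12,1]$ be the inversor of the $A_2$-representation, $$I\left(\Delta^{A_2}_{\left(\frac12\right)^{\alpha_1}\left(\frac12\right)^{\alpha_2}\ldots\left(\frac12\right)^{\alpha_n}\ldots}\right)=\Delta^{A_2}_{\left(\frac12\right)^{1-\alpha_1}\left(\frac12\right)^{1-\alpha_2}\ldots\left(\frac12\right)^{1-\alpha_n}\ldots},\qquad \alpha_n\in\{0,1\}.$$ Then for every $x\in[\frac12,1]$, $$I(x)=f\left(\bar f^{-1}(x)\right).$$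
   Context: For a sequence $(\alpha_n)_{n\ge1}$ with $\alpha_n\in\{0,1\}$, $\Delta^2_{\alpha_1\alpha_2\ldots\alpha_n\ldots}=\sum_{n=1}^\infty \frac{\alpha_n}{2^n}\in[0,1]$ denotes the classical binary representation. Let $A_2=\{\frac12,1\}$. For a sequence $(a_n)_{n\ge1}$ with $a_n\in A_2$, $\Delta^{A_2}_{a_1a_2\ldots a_n\ldots}$ denotes the value of the infinite continued fraction $$[0;a_1,a_2,a_3,\ldots]=\cfrac{1}{a_1+\cfrac{1}{a_2+\cfrac{1}{a_3+\cdots}}},$$ i.e. the limit of its convergents $p_n/q_n$, where $p_n=a_np_{n-1}+p_{n-2}$, $q_n=a_nq_{n-1}+q_{n-2}$ for $n\ge1$, with $p_0=0$, $q_0=1$, $p_{-1}=1$, $q_{-1}=0$. These limits exist and lie in $[\frac12,1]$, and every $x\in[\frac12,1]$ has at least one such representation. In the definition of $f$, the $n$-th digit is $(\frac12)^{1-\alpha_n}$ for odd $n$ and $(\frac12)^{\alpha_n}$ for even $n$; in the definition of $\bar f$, it is $(\frac12)^{\alpha_n}$ for odd $n$ and $(\frac12)^{1-\alpha_n}$ for even $n$. The functions $f$, $\bar f$ and $I$ are well-defined (the values do not depend on the chosen representation of the argument), and $\bar f^{-1}:[\frac12,1]\to[0,1]$ denotes the inverse of the bijection $\bar f$. *)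

theory Defs
  imports "HOL-Analysis.Analysis"
begin

text \<open>
  Sequences \<open>(s\<^sub>n)\<close> with \<open>n \<ge> 1\<close> are functions on \<^typ>\<open>nat\<close> whose value at \<open>0\<close> is ignored,
  so that the parity of an index is the one used in the mathematics.
\<close>

definition binary_seq :: "(nat \<Rightarrow> nat) \<Rightarrow> bool" where
  "binary_seq \<alpha> \<longleftrightarrow> (\<forall>n\<ge>1. \<alpha> n \<in> {0, 1})"

definition binary_value :: "(nat \<Rightarrow> nat) \<Rightarrow> real" where
  "binary_value \<alpha> = (\<Sum>n. real (\<alpha> (Suc n)) / 2 ^ Suc n)"

text \<open>
  Numerators and denominators of the convergents of \<open>[0; a\<^sub>1, a\<^sub>2, \<dots>]\<close>. The clauses for
  index 1 are the general recurrence evaluated with \<open>p\<^sub>0 = 0\<close>, \<open>q\<^sub>0 = 1\<close> and, at index \<open>-1\<close>,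
  the values 1 and 0 for numerator and denominator.
\<close>

fun cf_num :: "(nat \<Rightarrow> real) \<Rightarrow> nat \<Rightarrow> real" where
  "cf_num a 0 = 0"
| "cf_num a (Suc 0) = a 1 * 0 + 1"
| "cf_num a (Suc (Suc n)) = a (Suc (Suc n)) * cf_num a (Suc n) + cf_num a n"

fun cf_den :: "(nat \<Rightarrow> real) \<Rightarrow> nat \<Rightarrow> real" where
  "cf_den a 0 = 1"
| "cf_den a (Suc 0) = a 1 * 1 + 0"
| "cf_den a (Suc (Suc n)) = a (Suc (Suc n)) * cf_den a (Suc n) + cf_den a n"

definition cf_value :: "(nat \<Rightarrow> real) \<Rightarrow> real" where
  "cf_value a = lim (\<lambda>n. cf_num a n / cf_den a n)"

text \<open>
  The three functions are given by their action on representations; the definite description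
  picks the common value over all representations of the argument. On \<^typ>\<open>nat\<close>, \<open>1 - \<alpha> n\<close> is
  the complementary binary digit, without truncation, since \<open>\<alpha> n \<in> {0, 1}\<close>.
\<close>

definition f_map :: "real \<Rightarrow> real" where
  "f_map x = (THE y. \<exists>\<alpha>. binary_seq \<alpha> \<and> x = binary_value \<alpha> \<and>
     y = cf_value (\<lambda>n. if odd n then (1/2) ^ (1 - \<alpha> n) else (1/2) ^ \<alpha> n))"

definition f_bar :: "real \<Rightarrow> real" where
  "f_bar x = (THE y. \<exists>\<alpha>. binary_seq \<alpha> \<and> x = binary_value \<alpha> \<and>
     y = cf_value (\<lambda>n. if odd n then (1/2) ^ \<alpha> n else (1/2) ^ (1 - \<alpha> n)))"

definition inversor :: "real \<Rightarrow> real" where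
  "inversor x = (THE y. \<exists>\<alpha>. binary_seq \<alpha> \<and> x = cf_value (\<lambda>n. (1/2) ^ \<alpha> n) \<and>
     y = cf_value (\<lambda>n. (1/2) ^ (1 - \<alpha> n)))"

end

theory Submission
  imports Defs
begin

text \<open>
  Write a digit sequence as a sequence of truth values, with \<open>True\<close> for the digit \<open>1/2\<close>. Both its
  continued fraction and the binary expansion with every second digit complemented are
  computed by prepending digits through strictly decreasing branches whose images cover an
  interval and meet in one point. In any such system the same pairs of sequences share a
  value, so both values determine each other. Complementing all digits turns the binary value
  \<open>v\<close> into \<open>1 - v\<close>, hence respects these pairs too.
\<close>

section \<open>Codings by decreasing branches\<close>

text \<open>\<open>unique\<close> stands in for contraction: any orbit inside the interval that
  follows the digits determines the value. The endpoint conditions place the \<open>False\<close>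
  branch below the meeting point and the \<open>True\<close> branch above it.\<close>

locale reversing_coding =
  fixes V :: "(nat \<Rightarrow> bool) \<Rightarrow> real"
    and \<phi> :: "bool \<Rightarrow> real \<Rightarrow> real"
    and lo hi :: real
  assumes lo_less_hi: "lo < hi"
    and unfold: "V s = \<phi> (s 0) (V (\<lambda>i. s (Suc i)))"
    and range: "V s \<in> {lo..hi}"
    and unique: "(\<And>n. z n \<in> {lo..hi}) \<Longrightarrow> (\<And>n. z n = \<phi> (s n) (z (Suc n))) \<Longrightarrow> V s = z 0"
    and anti: "x \<in> {lo..hi} \<Longrightarrow> y \<in> {lo..hi} \<Longrightarrow> x < y \<Longrightarrow> \<phi> b y < \<phi> b x"
    and false_hi: "\<phi> False hi = lo"
    and true_lo: "\<phi> True lo = hi"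
    and meet: "\<phi> False lo = \<phi> True hi"
    and cover: "x \<in> {lo..hi} \<Longrightarrow> \<exists>b. \<exists>t\<in>{lo..hi}. x = \<phi> b t"
begin

lemma branch_inj: "x \<in> {lo..hi} \<Longrightarrow> y \<in> {lo..hi} \<Longrightarrow> \<phi> b x = \<phi> b y \<longleftrightarrow> x = y"
  using anti[of x y b] anti[of y x b] by (cases x y rule: linorder_cases) auto

lemma branch_antimono: "x \<in> {lo..hi} \<Longrightarrow> y \<in> {lo..hi} \<Longrightarrow> x \<le> y \<Longrightarrow> \<phi> b y \<le> \<phi> b x"
  using anti[of x y b] by (cases "x = y") auto

lemma endpoints_mem: "lo \<in> {lo..hi}" "hi \<in> {lo..hi}"
  using lo_less_hi by auto

lemma branch_eq_hi_iff:
  assumes "x \<in> {lo..hi}"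
  shows "\<phi> b x = hi \<longleftrightarrow> b \<and> x = lo"
proof (cases b)
  case True
  then show ?thesis using branch_inj[OF assms endpoints_mem(1), of True] true_lo by auto
next
  case False
  have "\<phi> False x \<le> \<phi> False lo" using branch_antimono[OF endpoints_mem(1) assms] assms by auto
  also have "\<dots> < hi" using anti[OF endpoints_mem lo_less_hi, of True] meet true_lo by simp
  finally show ?thesis using False by simp
qed

lemma branch_eq_lo_iff:
  assumes "x \<in> {lo..hi}"
  shows "\<phi> b x = lo \<longleftrightarrow> \<not> b \<and> x = hi"
proof (cases b)
  case False
  then show ?thesis using branch_inj[OF assms endpoints_mem(2), of False] false_hi by auto
next
  case True
  have "lo < \<phi> True hi" using anti[OF endpoints_mem lo_less_hi, of False] meet false_hi by simp
  also have "\<dots> \<le> \<phi> True x" using branch_antimono[OF assms endpoints_mem(2)] assms by auto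
  finally show ?thesis using True by simp
qed

text \<open>Monotonicity keeps the \<open>True\<close> branch above the meeting point and the
  \<open>False\<close> branch below it, so a coincidence forces both arguments to be
  extreme.\<close>

lemma branch_true_eq_false_iff:
  assumes "x \<in> {lo..hi}" "y \<in> {lo..hi}"
  shows "\<phi> True x = \<phi> False y \<longleftrightarrow> x = hi \<and> y = lo"
proof -
  have "\<phi> True hi \<le> \<phi> True x" "\<phi> False y \<le> \<phi> False lo"
    using branch_antimono assms endpoints_mem by auto
  moreover have "\<phi> True x = \<phi> True hi \<longleftrightarrow> x = hi" "\<phi> False y = \<phi> False lo \<longleftrightarrow> y = lo"
    using branch_inj assms endpoints_mem by blast+
  ultimately show ?thesis using meet by auto
qed

text \<open>The two claims need a joint induction: decreasing branches swap the endpoints, so the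
  tail of a code of \<open>hi\<close> is a code of \<open>lo\<close> and conversely.\<close>

lemma digits_if_extremal:
  "(V s = hi \<longrightarrow> s i = even i) \<and> (V s = lo \<longrightarrow> s i = odd i)"
proof (induction i arbitrary: s)
  case 0
  then show ?case using unfold[of s] branch_eq_hi_iff[OF range] branch_eq_lo_iff[OF range] by auto
next
  case (Suc i)
  have "V s = hi \<Longrightarrow> V (\<lambda>i. s (Suc i)) = lo" "V s = lo \<Longrightarrow> V (\<lambda>i. s (Suc i)) = hi"
    using unfold[of s] branch_eq_hi_iff[OF range] branch_eq_lo_iff[OF range] by auto
  then show ?case using Suc.IH[of "\<lambda>i. s (Suc i)"] by auto
qed

lemma eq_hi_iff: "V s = hi \<longleftrightarrow> (\<forall>i. s i = even i)"
proof
  assume "\<forall>i. s i = even i"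
  \<comment> \<open>The orbit \<open>hi\<close>, \<open>lo\<close>, \<open>hi\<close>, ... follows
    these digits, by \<open>true_lo\<close> and \<open>false_hi\<close>.\<close>
  then show "V s = hi"
    using unique[of "\<lambda>n. if even n then hi else lo" s] lo_less_hi true_lo false_hi by auto
qed (use digits_if_extremal in blast)

lemma eq_lo_iff: "V s = lo \<longleftrightarrow> (\<forall>i. s i = odd i)"
proof
  assume "\<forall>i. s i = odd i"
  then show "V s = lo"
    using unique[of "\<lambda>n. if even n then lo else hi" s] lo_less_hi true_lo false_hi by auto
qed (use digits_if_extremal in blast)

lemma eq_iff_drop_prefix:
  assumes "\<forall>i<n. s i = t i"
  shows "V s = V t \<longleftrightarrow> V (\<lambda>i. s (n + i)) = V (\<lambda>i. t (n + i))"
  using assms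
proof (induction n arbitrary: s t)
  case (Suc n)
  have "V s = V t \<longleftrightarrow> V (\<lambda>i. s (Suc i)) = V (\<lambda>i. t (Suc i))"
    using unfold[of s] unfold[of t] branch_inj[OF range range] Suc.prems by simp
  then show ?case using Suc.IH[of "\<lambda>i. s (Suc i)" "\<lambda>i. t (Suc i)"] Suc.prems by simp
qed simp

text \<open>Equality pushes the tails to \<open>hi\<close> and \<open>lo\<close>, each of which has
  exactly one code. The criterion mentions digits only, so it is the same for every coding.\<close>

lemma eq_iff_if_heads_differ:
  assumes "s 0" "\<not> t 0"
  shows "V s = V t \<longleftrightarrow> (\<forall>i. s (Suc i) = even i) \<and> (\<forall>i. t (Suc i) = odd i)"
  using unfold[of s] unfold[of t] branch_true_eq_false_iff[OF range range]
    eq_hi_iff[of "\<lambda>i. s (Suc i)"] eq_lo_iff[of "\<lambda>i. t (Suc i)"] assms by simp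

lemma surjective:
  assumes "x \<in> {lo..hi}"
  shows "\<exists>s. V s = x"
proof -
  \<comment> \<open>\<open>d\<close> chooses a first digit and \<open>r\<close> the remaining point;
    iterating \<open>r\<close> expands \<open>x\<close>.\<close>
  obtain d r where dr: "\<And>y. y \<in> {lo..hi} \<Longrightarrow> r y \<in> {lo..hi} \<and> y = \<phi> (d y) (r y)"
    using cover by metis
  define y where "y n = (r ^^ n) x" for n
  have mem: "y n \<in> {lo..hi}" for n
    by (induction n) (use assms dr in \<open>auto simp: y_def\<close>)
  have "y n = \<phi> (d (y n)) (y (Suc n))" for n
    using dr[OF mem[of n]] by (simp add: y_def)
  then have "V (\<lambda>n. d (y n)) = y 0"
    using unique[of y "\<lambda>n. d (y n)"] mem by blast
  then show ?thesis by (auto simp: y_def)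
qed

end

text \<open>After cancelling the common prefix up to the first difference, both equalities reduce to
  the same condition on digits.\<close>

lemma reversing_codings_identify_same:
  assumes "reversing_coding V \<phi> lo hi" "reversing_coding V' \<phi>' lo' hi'"
  shows "V s = V t \<longleftrightarrow> V' s = V' t"
proof (cases "s = t")
  case False
  interpret A: reversing_coding V \<phi> lo hi by fact
  interpret B: reversing_coding V' \<phi>' lo' hi' by fact
  from False obtain n where n: "s n \<noteq> t n" "\<forall>i<n. s i = t i"
    using exists_least_iff[of "\<lambda>n. s n \<noteq> t n"] by auto
  let ?s = "\<lambda>i. s (n + i)" and ?t = "\<lambda>i. t (n + i)"
  have "V ?s = V ?t \<longleftrightarrow> V' ?s = V' ?t"
  proof (cases "s n")
    case True
    then show ?thesis
      using n A.eq_iff_if_heads_differ[of ?s ?t] B.eq_iff_if_heads_differ[of ?s ?t] by simp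
  next
    case False
    then show ?thesis
      using n A.eq_iff_if_heads_differ[of ?t ?s] B.eq_iff_if_heads_differ[of ?t ?s]
      by (simp add: eq_commute)
  qed
  then show ?thesis
    using A.eq_iff_drop_prefix[OF n(2)] B.eq_iff_drop_prefix[OF n(2)] by simp
qed simp

section \<open>Continued fractions with digits 1/2 and 1\<close>

text \<open>The finite fraction whose last denominator is \<open>a n + t\<close>. It peels digits
  off the front, whereas the convergent recurrences append them at the end; \<open>t = 0\<close>
  gives the convergent.\<close>

primrec cf_tail :: "(nat \<Rightarrow> real) \<Rightarrow> nat \<Rightarrow> real \<Rightarrow> real" where
  "cf_tail a 0 t = t"
| "cf_tail a (Suc n) t = 1 / (a 1 + cf_tail (\<lambda>k. a (Suc k)) n t)"

definition A2_seq :: "(nat \<Rightarrow> real) \<Rightarrow> bool" where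
  "A2_seq a \<longleftrightarrow> (\<forall>n\<ge>1. a n \<in> {1/2, 1})"

lemma A2_seq_shift: "A2_seq a \<Longrightarrow> A2_seq (\<lambda>k. a (Suc k))"
  by (auto simp: A2_seq_def)

lemma A2_seq_1: "A2_seq a \<Longrightarrow> a 1 = 1/2 \<or> a 1 = 1"
  by (auto simp: A2_seq_def)

lemma cf_num_den_shift:
  "cf_num a (Suc n) = cf_den (\<lambda>k. a (Suc k)) n \<and>
   cf_den a (Suc n) = a 1 * cf_den (\<lambda>k. a (Suc k)) n + cf_num (\<lambda>k. a (Suc k)) n"
  by (induction n rule: induct_nat_012) (auto simp: algebra_simps)

lemma cf_den_pos: "A2_seq a \<Longrightarrow> cf_den a n > 0"
proof (induction n rule: induct_nat_012)
  case (ge2 n)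
  then have "a (Suc (Suc n)) \<in> {1/2, 1}" by (simp add: A2_seq_def)
  then have "a (Suc (Suc n)) > 0" by auto
  then show ?case using ge2 by (simp add: add_pos_pos)
qed (auto dest: A2_seq_1)

lemma convergent_eq_cf_tail: "A2_seq a \<Longrightarrow> cf_num a n / cf_den a n = cf_tail a n 0"
proof (induction n arbitrary: a)
  case (Suc n)
  let ?a = "\<lambda>k. a (Suc k)"
  have "cf_num a (Suc n) / cf_den a (Suc n) = 1 / (a 1 + cf_num ?a n / cf_den ?a n)"
    using cf_num_den_shift[of a n] cf_den_pos[OF A2_seq_shift[OF Suc.prems], of n]
    by (simp add: field_simps)
  then show ?case using Suc.IH[OF A2_seq_shift[OF Suc.prems]] by simp
qed simp

text \<open>Convergents start from the tail 0, outside \<open>{1/2..1}\<close>; the larger invariant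
  interval allows for it, with 2 reached as \<open>1 / (1/2 + 0)\<close>.\<close>

lemma cf_branch_0_2:
  assumes "t \<in> {0..2}" "d = 1/2 \<or> d = (1::real)"
  shows "1 / (d + t) \<in> {0..2}"
  using assms(2) by (elim disjE; hypsubst) (use assms(1) in \<open>auto simp: field_simps\<close>)

lemma cf_tail_0_2: "A2_seq a \<Longrightarrow> t \<in> {0..2} \<Longrightarrow> cf_tail a n t \<in> {0..2}"
proof (induction n arbitrary: a)
  case (Suc n)
  then show ?case
    using cf_branch_0_2[OF Suc.IH[OF A2_seq_shift] A2_seq_1] by simp
qed simp

lemma cf_tail_half_1: "A2_seq a \<Longrightarrow> t \<in> {1/2..1} \<Longrightarrow> cf_tail a n t \<in> {1/2..1}"
proof (induction n arbitrary: a)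
  case (Suc n)
  then have "cf_tail (\<lambda>k. a (Suc k)) n t \<in> {1/2..1}" using A2_seq_shift by blast
  then show ?case using A2_seq_1[OF Suc.prems(1)] by (auto simp: field_simps)
qed simp

lemma cf_tail_add:
  "cf_tail a (n + m) t = cf_tail a n (cf_tail (\<lambda>k. a (n + k)) m t)"
  by (induction n arbitrary: a) simp_all

text \<open>
  One branch need not contract for arguments up to \<open>1/2\<close>, but two do: the slope of the composition
  is a product of two factors \<open>1 / (1 + d * (e + v))\<close>, each at most \<open>4/5\<close>.
\<close>

lemma cf_branch_twice_contracts:
  fixes d e t u :: real
  assumes "t \<in> {0..2}" "u \<in> {0..2}" "d = 1/2 \<or> d = 1" "e = 1/2 \<or> e = 1"
  shows "\<bar>1 / (d + 1 / (e + t)) - 1 / (d + 1 / (e + u))\<bar> \<le> (4/5)\<^sup>2 * \<bar>t - u\<bar>"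
proof -
  define g where "g v = 1 / (1 + d * (e + v))" for v
  \<comment> \<open>Hence each factor is at most \<open>1 / (1 + 1/4) = 4/5\<close>.\<close>
  have quarter: "1/4 \<le> d * (e + v)" if "v \<in> {0..2}" for v
    using mult_mono[of "1/2" d "1/2" "e + v"] assms(3,4) that by auto
  have g: "0 \<le> g v" "g v \<le> 4/5" if "v \<in> {0..2}" for v
    using quarter[OF that] by (auto simp: g_def field_simps)
  have inv: "1 / (d + 1 / (e + v)) = (e + v) / (1 + d * (e + v))" if "v \<in> {0..2}" for v
  proof -
    have "e + v > 0" using assms(4) that by auto
    then show ?thesis by (simp add: field_simps)
  qed
  have "1 + d * (e + t) \<noteq> 0" "1 + d * (e + u) \<noteq> 0"
    using quarter[OF assms(1)] quarter[OF assms(2)] by auto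
  then have "1 / (d + 1 / (e + t)) - 1 / (d + 1 / (e + u)) = g t * g u * (t - u)"
    unfolding inv[OF assms(1)] inv[OF assms(2)] g_def
    by (simp add: diff_frac_eq) (simp add: algebra_simps)
  then have "\<bar>1 / (d + 1 / (e + t)) - 1 / (d + 1 / (e + u))\<bar> = g t * g u * \<bar>t - u\<bar>"
    using g[OF assms(1)] g[OF assms(2)] by (simp add: abs_mult)
  moreover have "g t * g u \<le> 4/5 * (4/5)"
    using g[OF assms(1)] g[OF assms(2)] by (intro mult_mono) auto
  ultimately show ?thesis
    by (simp only: power2_eq_square) (rule mult_right_mono, auto)
qed

text \<open>The contraction estimate consumes two digits, so the induction has two base cases. The
  constant 3 covers both: the interval has length 2, and \<open>3 * (4/5) = 12/5\<close> still
  exceeds it.\<close>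

lemma cf_tail_contracts:
  assumes "A2_seq a" "t \<in> {0..2}" "u \<in> {0..2}"
  shows "\<bar>cf_tail a n t - cf_tail a n u\<bar> \<le> 3 * (4/5) ^ n"
  using assms
proof (induction n arbitrary: a rule: induct_nat_012)
  case 1
  have "\<bar>x - y\<bar> \<le> 12/5" if "x \<in> {0..2}" "y \<in> {0..2}" for x y :: real
    using that unfolding atLeastAtMost_iff by linarith
  from this[OF cf_branch_0_2[OF 1(2) A2_seq_1[OF 1(1)]] cf_branch_0_2[OF 1(3) A2_seq_1[OF 1(1)]]]
  show ?case by simp
next
  case (ge2 n)
  let ?a = "\<lambda>k. a (Suc (Suc k))"
  have A: "A2_seq ?a" using A2_seq_shift[OF A2_seq_shift[OF ge2.prems(1)]] .
  have "\<bar>cf_tail a (Suc (Suc n)) t - cf_tail a (Suc (Suc n)) u\<bar>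
      \<le> (4/5)\<^sup>2 * \<bar>cf_tail ?a n t - cf_tail ?a n u\<bar>"
    using cf_branch_twice_contracts[OF cf_tail_0_2[OF A ge2.prems(2)] cf_tail_0_2[OF A ge2.prems(3)]
        A2_seq_1[OF ge2.prems(1)] A2_seq_1[OF A2_seq_shift[OF ge2.prems(1)]]] by simp
  also have "\<dots> \<le> (4/5)\<^sup>2 * (3 * (4/5) ^ n)"
    using ge2.IH(1)[OF A ge2.prems(2,3)] by (intro mult_left_mono) auto
  finally show ?case by (simp add: power2_eq_square)
qed (auto simp: abs_le_iff)

text \<open>Contraction erases the tail, so any choice of tails gives the same limit. The freedom is
  used later: tail 1 locates the value, and an orbit as tails identifies it.\<close>

lemma cf_tail_tendsto:
  assumes "A2_seq a" and u: "\<And>n. u n \<in> {0..2}"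
  shows "(\<lambda>n. cf_tail a n (u n)) \<longlonglongrightarrow> cf_value a"
proof -
  have A: "A2_seq (\<lambda>k. a (n + k))" for n using assms(1) by (auto simp: A2_seq_def)
  have small: "(\<lambda>n. 3 * (4/5::real) ^ n) \<longlonglongrightarrow> 0"
    by (intro tendsto_mult_right_zero LIMSEQ_realpow_zero) auto
  have close: "\<bar>cf_tail a m 0 - cf_tail a n 0\<bar> \<le> 3 * (4/5) ^ n" if "n \<le> m" for m n
  proof -
    \<comment> \<open>A longer convergent is the first \<open>n\<close> digits applied to another
      admissible tail.\<close>
    have "cf_tail a m 0 = cf_tail a n (cf_tail (\<lambda>k. a (n + k)) (m - n) 0)"
      using cf_tail_add[of a n "m - n" 0] that by simp
    then show ?thesis using cf_tail_contracts[OF assms(1) cf_tail_0_2[OF A[of n]], of 0 0] by simp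
  qed
  have "Cauchy (\<lambda>n. cf_tail a n 0)"
  proof (rule metric_CauchyI)
    fix e :: real assume "e > 0"
    then obtain N where N: "3 * (4/5) ^ N < e / 2"
      using order_tendstoD(2)[OF small, of "e / 2"] by (auto simp: eventually_sequentially)
    have "dist (cf_tail a m 0) (cf_tail a n 0) < e" if "m \<ge> N" "n \<ge> N" for m n
      using close[OF that(1)] close[OF that(2)] N unfolding dist_real_def by argo
    then show "\<exists>M. \<forall>m\<ge>M. \<forall>n\<ge>M. dist (cf_tail a m 0) (cf_tail a n 0) < e" by blast
  qed
  then have "convergent (\<lambda>n. cf_num a n / cf_den a n)"
    by (simp add: Cauchy_convergent_iff convergent_eq_cf_tail[OF assms(1)])
  then have lim0: "(\<lambda>n. cf_tail a n 0) \<longlonglongrightarrow> cf_value a"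
    unfolding cf_value_def convergent_LIMSEQ_iff by (simp add: convergent_eq_cf_tail[OF assms(1)])
  have "(\<lambda>n. cf_tail a n (u n) - cf_tail a n 0) \<longlonglongrightarrow> 0"
    by (rule Lim_null_comparison[OF always_eventually small])
      (use cf_tail_contracts[OF assms(1) u, of 0] in auto)
  from tendsto_add[OF this lim0] show ?thesis by simp
qed

lemma cf_value_range:
  assumes "A2_seq a"
  shows "cf_value a \<in> {1/2..1}"
proof (rule closed_sequentially[OF closed_atLeastAtMost])
  show "(\<lambda>n. cf_tail a n 1) \<longlonglongrightarrow> cf_value a" using cf_tail_tendsto[OF assms] by simp
qed (use cf_tail_half_1[OF assms] in auto)

lemma cf_value_unfold:
  assumes "A2_seq a"
  shows "cf_value a = 1 / (a 1 + cf_value (\<lambda>k. a (Suc k)))"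
proof (rule LIMSEQ_unique)
  show "(\<lambda>n. cf_tail a (Suc n) 0) \<longlonglongrightarrow> cf_value a"
    by (rule LIMSEQ_Suc, rule cf_tail_tendsto[OF assms]) simp
  have "a 1 + cf_value (\<lambda>k. a (Suc k)) \<noteq> 0"
    using A2_seq_1[OF assms] cf_value_range[OF A2_seq_shift[OF assms]] by auto
  then show "(\<lambda>n. cf_tail a (Suc n) 0) \<longlonglongrightarrow> 1 / (a 1 + cf_value (\<lambda>k. a (Suc k)))"
    using cf_tail_tendsto[OF A2_seq_shift[OF assms], of "\<lambda>_. 0"]
    by (auto intro!: tendsto_intros)
qed

text \<open>Feeding \<open>x n\<close> in as the tail after \<open>n\<close> digits returns
  \<open>x 0\<close> for every \<open>n\<close>, so the limit is that of a constant
  sequence.\<close>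

lemma cf_value_eqI:
  assumes "A2_seq a" "\<And>n. x n \<in> {0..2}" "\<And>n. x n = 1 / (a (Suc n) + x (Suc n))"
  shows "cf_value a = x 0"
proof -
  have "cf_tail a n (x n) = x 0" for n
    using assms(3)
  proof (induction n arbitrary: a x)
    case (Suc n)
    have "cf_tail (\<lambda>k. a (Suc k)) n (x (Suc n)) = x 1"
      using Suc.IH[of "\<lambda>n. x (Suc n)" "\<lambda>k. a (Suc k)", OF Suc.prems] by simp
    then show ?case using Suc.prems[of 0] by simp
  qed (rule cf_tail.simps(1))
  then have "(\<lambda>n. x 0) \<longlonglongrightarrow> cf_value a"
    using cf_tail_tendsto[OF assms(1), of x, OF assms(2)] by simp
  then show ?thesis by (simp add: LIMSEQ_const_iff)
qed

lemma cf_value_cong: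
  assumes "\<And>n. n \<ge> 1 \<Longrightarrow> a n = b n"
  shows "cf_value a = cf_value b"
proof -
  have "cf_num a n = cf_num b n \<and> cf_den a n = cf_den b n" for n
    by (induction n rule: induct_nat_012) (simp_all add: assms)
  then show ?thesis by (simp add: cf_value_def)
qed

text \<open>Truth values are indexed from 0 and digits from 1; the truncated \<open>n - 1\<close> at
  index 0 is harmless, since that digit is never read.\<close>

definition cf_code :: "(nat \<Rightarrow> bool) \<Rightarrow> real" where
  "cf_code s = cf_value (\<lambda>n. if s (n - 1) then 1/2 else 1)"

lemma A2_seq_code: "A2_seq (\<lambda>n. if s n then 1/2 else 1)"
  by (simp add: A2_seq_def)

lemma cf_code_shift:
  "cf_code (\<lambda>i. s (Suc i)) = cf_value (\<lambda>n. if s n then 1/2 else 1)"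
  unfolding cf_code_def by (rule cf_value_cong) simp

lemma cf_code_coding:
  "reversing_coding cf_code (\<lambda>b t. 1 / ((if b then 1/2 else 1) + t)) (1/2) 1"
proof
  show "cf_code s = 1 / ((if s 0 then 1/2 else 1) + cf_code (\<lambda>i. s (Suc i)))" for s
    unfolding cf_code_shift[of s] unfolding cf_code_def
    using cf_value_unfold[OF A2_seq_code[of "\<lambda>n. s (n - 1)"]] by simp
  show "cf_code s \<in> {1/2..1}" for s
    unfolding cf_code_def by (rule cf_value_range[OF A2_seq_code])
  show "cf_code s = x 0"
    if "\<And>n. x n \<in> {1/2..1}" "\<And>n. x n = 1 / ((if s n then 1/2 else 1) + x (Suc n))" for s x
    unfolding cf_code_def
  proof (rule cf_value_eqI[OF A2_seq_code])
    show "x n \<in> {0..2}" for n using that(1)[of n] by auto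
    show "x n = 1 / ((if s (Suc n - 1) then 1/2 else 1) + x (Suc n))" for n
      using that(2)[of n] by simp
  qed
  show "\<exists>b. \<exists>t\<in>{1/2..1}. x = 1 / ((if b then 1/2 else 1) + t)" if "x \<in> {1/2..1}" for x :: real
  \<comment> \<open>2/3 is the meeting point, \<open>1 / (1/2 + 1) = 1 / (1 + 1/2)\<close>; each
    witness solves \<open>x = 1 / (d + t)\<close>.\<close>
  proof (cases "x \<ge> 2/3")
    case True
    then show ?thesis
      using that by (intro exI[of _ True] bexI[of _ "1 / x - 1/2"]) (auto simp: field_simps)
  next
    case False
    then show ?thesis
      using that by (intro exI[of _ False] bexI[of _ "1 / x - 1"]) (auto simp: field_simps)
  qed
qed (auto simp: field_simps)

section \<open>Binary expansions with every second digit complemented\<close>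

text \<open>Complementing the even positions makes prepending a digit order-reversing, as for
  continued fractions.\<close>

definition alt_binary :: "(nat \<Rightarrow> bool) \<Rightarrow> real" where
  "alt_binary s = binary_value (\<lambda>n. of_bool (s (n - 1) = odd n))"

lemma alt_binary_eq: "alt_binary s = (\<Sum>n. of_bool (s n = even n) / 2 ^ Suc n)"
  by (simp add: alt_binary_def binary_value_def)

lemma alt_binary_summable: "summable (\<lambda>n. of_bool (P n) / 2 ^ Suc n :: real)"
proof (rule summable_comparison_test')
  show "summable (\<lambda>n. (1/2) ^ Suc n :: real)"
    using power_half_series by (rule sums_summable)
qed (auto simp: power_divide)

text \<open>At each position exactly one of the two expansions has digit 1, so they add up to the
  full geometric series.\<close>

lemma alt_binary_neg: "alt_binary (\<lambda>i. \<not> s i) = 1 - alt_binary s"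
proof -
  have "alt_binary (\<lambda>i. \<not> s i) + alt_binary s =
      (\<Sum>n. of_bool ((\<not> s n) = even n) / 2 ^ Suc n + of_bool (s n = even n) / 2 ^ Suc n)"
    unfolding alt_binary_eq by (intro suminf_add alt_binary_summable)
  also have "\<dots> = (\<Sum>n. (1/2) ^ Suc n)"
    by (intro suminf_cong) (auto simp: power_divide)
  also have "\<dots> = 1" using power_half_series sums_unique by metis
  finally show ?thesis by simp
qed

lemma alt_binary_unfold:
  "alt_binary s = (of_bool (s 0) + 1 - alt_binary (\<lambda>i. s (Suc i))) / 2"
proof -
  \<comment> \<open>Dropping a digit shifts parity, so the tail appears negated;
    \<open>alt_binary_neg\<close> then supplies the minus sign.\<close>
  let ?t = "\<lambda>i. \<not> s (Suc i)"
  have "alt_binary s = (\<Sum>n. of_bool (s (Suc n) = even (Suc n)) / 2 ^ Suc (Suc n)) + of_bool (s 0) / 2"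
    unfolding alt_binary_eq
    using suminf_split_head[OF alt_binary_summable[of "\<lambda>n. s n = even n"]] by simp
  also have "(\<Sum>n. of_bool (s (Suc n) = even (Suc n)) / 2 ^ Suc (Suc n) :: real) =
      (\<Sum>n. of_bool (?t n = even n) / 2 ^ Suc n / 2)"
    by (intro suminf_cong) (auto simp: mult.commute)
  also have "\<dots> = alt_binary ?t / 2"
    unfolding alt_binary_eq by (rule suminf_divide[OF alt_binary_summable])
  finally show ?thesis using alt_binary_neg[of "\<lambda>i. s (Suc i)"] by simp
qed

lemma alt_binary_range: "alt_binary s \<in> {0..1}"
proof -
  have nonneg: "alt_binary t \<ge> 0" for t
    unfolding alt_binary_eq by (intro suminf_nonneg alt_binary_summable) simp
  show ?thesis using nonneg[of s] nonneg[of "\<lambda>i. \<not> s i"] alt_binary_neg[of s] by simp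
qed

lemma alt_binary_coding:
  "reversing_coding alt_binary (\<lambda>b t. (of_bool b + 1 - t) / 2) 0 1"
proof
  show "alt_binary s = x 0"
    if x: "\<And>n. x n \<in> {0..1}" "\<And>n. x n = (of_bool (s n) + 1 - x (Suc n)) / 2" for s x
  proof -
    \<comment> \<open>Both branches have slope -1/2, so each digit halves the error, which is at
      most 1 initially.\<close>
    have "\<bar>alt_binary s - x 0\<bar> \<le> (1/2) ^ n" for n
      using x(1) x(2)
    proof (induction n arbitrary: s x)
      case 0
      show ?case using alt_binary_range[of s] "0"(1)[of 0] by (auto simp: abs_le_iff)
    next
      case (Suc n)
      have "\<bar>alt_binary (\<lambda>i. s (Suc i)) - x 1\<bar> \<le> (1/2) ^ n"
        using Suc.IH[of "\<lambda>n. x (Suc n)" "\<lambda>i. s (Suc i)", OF Suc.prems] by simp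
      then show ?case using alt_binary_unfold[of s] Suc.prems(2)[of 0]
        by (simp add: abs_if split: if_splits)
    qed
    moreover have "(\<lambda>n. (1/2::real) ^ n) \<longlonglongrightarrow> 0" by (intro LIMSEQ_realpow_zero) auto
    ultimately have "\<bar>alt_binary s - x 0\<bar> \<le> 0"
      by (intro LIMSEQ_le_const) auto
    then show ?thesis by simp
  qed
  show "\<exists>b. \<exists>t\<in>{0..1}. x = (of_bool b + 1 - t) / 2" if "x \<in> {0..1}" for x :: real
  proof (cases "x \<ge> 1/2")
    case True
    then show ?thesis
      using that by (intro exI[of _ True] bexI[of _ "2 - 2 * x"]) auto
  next
    case False
    then show ?thesis
      using that by (intro exI[of _ False] bexI[of _ "1 - 2 * x"]) auto
  qed
  show "alt_binary s = (of_bool (s 0) + 1 - alt_binary (\<lambda>i. s (Suc i))) / 2" for s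
    by (rule alt_binary_unfold)
  show "alt_binary s \<in> {0..1}" for s
    by (rule alt_binary_range)
qed auto

section \<open>The three maps on sequences\<close>

text \<open>This is what makes all three definite descriptions below well defined.\<close>

lemma cf_code_eq_iff: "cf_code s = cf_code t \<longleftrightarrow> alt_binary s = alt_binary t"
  using reversing_codings_identify_same[OF cf_code_coding alt_binary_coding] .

lemma binary_value_cong:
  assumes "\<And>n. n \<ge> 1 \<Longrightarrow> \<alpha> n = \<beta> n"
  shows "binary_value \<alpha> = binary_value \<beta>"
  using assms by (simp add: binary_value_def)

lemma binary_seq_raw_code:
  assumes "binary_seq \<alpha>"
  obtains s where "cf_value (\<lambda>n. (1/2) ^ \<alpha> n) = cf_code s"
    and "cf_value (\<lambda>n. (1/2) ^ (1 - \<alpha> n)) = cf_code (\<lambda>i. \<not> s i)"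
proof
  have \<alpha>: "\<alpha> n = 0 \<or> \<alpha> n = 1" if "n \<ge> 1" for n using assms that by (auto simp: binary_seq_def)
  let ?s = "\<lambda>i. \<alpha> (Suc i) = 1"
  show "cf_value (\<lambda>n. (1/2) ^ \<alpha> n) = cf_code ?s"
    unfolding cf_code_def using \<alpha> by (intro cf_value_cong) force
  show "cf_value (\<lambda>n. (1/2) ^ (1 - \<alpha> n)) = cf_code (\<lambda>i. \<not> ?s i)"
    unfolding cf_code_def using \<alpha> by (intro cf_value_cong) force
qed

lemma binary_seq_code:
  assumes "binary_seq \<alpha>"
  obtains s where "binary_value \<alpha> = alt_binary s"
    and "cf_value (\<lambda>n. if odd n then (1/2) ^ \<alpha> n else (1/2) ^ (1 - \<alpha> n)) = cf_code s"
    and "cf_value (\<lambda>n. if odd n then (1/2) ^ (1 - \<alpha> n) else (1/2) ^ \<alpha> n) = cf_code (\<lambda>i. \<not> s i)"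
proof
  have \<alpha>: "\<alpha> n = 0 \<or> \<alpha> n = 1" if "n \<ge> 1" for n using assms that by (auto simp: binary_seq_def)
  \<comment> \<open>Position \<open>Suc i\<close> is odd exactly when \<open>i\<close> is even;
    there the digit is kept, elsewhere it is complemented.\<close>
  let ?s = "\<lambda>i. (\<alpha> (Suc i) = 1) = even i"
  show "binary_value \<alpha> = alt_binary ?s"
    unfolding alt_binary_def using \<alpha> by (intro binary_value_cong) force
  show "cf_value (\<lambda>n. if odd n then (1/2) ^ \<alpha> n else (1/2) ^ (1 - \<alpha> n)) = cf_code ?s"
    unfolding cf_code_def using \<alpha> by (intro cf_value_cong) force
  show "cf_value (\<lambda>n. if odd n then (1/2) ^ (1 - \<alpha> n) else (1/2) ^ \<alpha> n) = cf_code (\<lambda>i. \<not> ?s i)"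
    unfolding cf_code_def using \<alpha> by (intro cf_value_cong) force
qed

lemma f_bar_alt_binary: "f_bar (alt_binary s) = cf_code s"
  unfolding f_bar_def
proof (rule the_equality)
  let ?\<alpha> = "\<lambda>n. of_bool (s (n - 1) = odd n) :: nat"
  show "\<exists>\<alpha>. binary_seq \<alpha> \<and> alt_binary s = binary_value \<alpha> \<and>
      cf_code s = cf_value (\<lambda>n. if odd n then (1/2) ^ \<alpha> n else (1/2) ^ (1 - \<alpha> n))"
    by (intro exI[of _ ?\<alpha>])
      (auto simp: binary_seq_def alt_binary_def cf_code_def intro!: cf_value_cong)
qed (auto elim!: binary_seq_code simp: cf_code_eq_iff)

text \<open>Independence of the representation also needs negation to respect equal values, which
  follows from \<open>alt_binary_neg\<close>.\<close>

lemma f_map_alt_binary: "f_map (alt_binary s) = cf_code (\<lambda>i. \<not> s i)"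
  unfolding f_map_def
proof (rule the_equality)
  let ?\<alpha> = "\<lambda>n. of_bool (s (n - 1) = odd n) :: nat"
  show "\<exists>\<alpha>. binary_seq \<alpha> \<and> alt_binary s = binary_value \<alpha> \<and>
      cf_code (\<lambda>i. \<not> s i) = cf_value (\<lambda>n. if odd n then (1/2) ^ (1 - \<alpha> n) else (1/2) ^ \<alpha> n)"
    by (intro exI[of _ ?\<alpha>])
      (auto simp: binary_seq_def alt_binary_def cf_code_def intro!: cf_value_cong)
qed (auto elim!: binary_seq_code simp: cf_code_eq_iff alt_binary_neg)

text \<open>Equal fractions give equal alternating binary values; these stay equal under negation
  and carry back to equal fractions.\<close>

lemma inversor_cf_code: "inversor (cf_code s) = cf_code (\<lambda>i. \<not> s i)"
  unfolding inversor_def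
proof (rule the_equality)
  let ?\<alpha> = "\<lambda>n. of_bool (s (n - 1)) :: nat"
  show "\<exists>\<alpha>. binary_seq \<alpha> \<and> cf_code s = cf_value (\<lambda>n. (1/2) ^ \<alpha> n) \<and>
      cf_code (\<lambda>i. \<not> s i) = cf_value (\<lambda>n. (1/2) ^ (1 - \<alpha> n))"
    by (intro exI[of _ ?\<alpha>]) (auto simp: binary_seq_def cf_code_def intro!: cf_value_cong)
qed (auto elim!: binary_seq_raw_code simp: cf_code_eq_iff alt_binary_neg)

lemma inj_on_f_bar: "inj_on f_bar {0..1}"
proof (rule inj_onI)
  fix b c :: real
  assume "b \<in> {0..1}" "c \<in> {0..1}" and eq: "f_bar b = f_bar c"
  then obtain s t where "b = alt_binary s" "c = alt_binary t"
    using reversing_coding.surjective[OF alt_binary_coding] by metis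
  then show "b = c" using eq by (simp add: f_bar_alt_binary cf_code_eq_iff)
qed

theorem mainTheorem5:
  fixes x :: real
  assumes "x \<in> {1/2..1}"
  shows "inversor x = f_map (inv_into {0..1} f_bar x)"
proof -
  obtain s where s: "cf_code s = x"
    using reversing_coding.surjective[OF cf_code_coding assms] by blast
  \<comment> \<open>A single \<open>s\<close> now codes \<open>x\<close> and its preimage, and both
    sides of the claim negate it.\<close>
  have "inv_into {0..1} f_bar x = alt_binary s"
    using inv_into_f_f[OF inj_on_f_bar alt_binary_range[of s]] by (simp add: f_bar_alt_binary s)
  then show ?thesis
    using inversor_cf_code[of s] by (simp add: f_map_alt_binary s)
qed

end
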